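(* Let $S(\ell_1,\dots,\ell_k)$ be a spider tree with $k\ge3$ and $1\le\ell_1\le\cdots\le\ell_k$, and let $n=1+\sum_{i=1}^k\ell_i$ be its number of vertices. Set $R=n-1-\ell_k$ and $$H=\begin{cases}\ell_k/2, & \ell_k\text{ even},\\ n-(\ell_k+1)/2, & \ell_k\text{ odd}.\end{cases}$$ Suppose the hub receives label $H$ and the vertices of the arm of length $\ell_k$, in order going outward from the hub, are labeled by $$\mathrm{arm\_walk}\bigl(H,(n-\ell_k,n-\ell_k+1,\dots,n-1),\varepsilon,n\bigr),$$ with $\varepsilon=+1$ if $\ell_k$ is even and $\varepsilon=-1$ if $\ell_k$ is odd. Then that arm uses exactly the differences $\{n-\ell_k,\dots,n-1\}$. The unused labels (the elements of $\{0,\dots,n-1\}$ not used on the hub or on this arm) form one interval of integers $[A,B]$ of size $R$, adjacent to the hub label: $H=A-1$ when $\ell_k$ is even and $H=B+1$ when $\ell_k$ is odd. The remaining differences (the elements of $\{1,\dots,n-1\}$ not used on this arm) are $\{1,\dots,R\}$.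
   Context: The spider tree $S(\ell_1,\dots,\ell_k)$ is obtained from a central hub vertex by attaching $k$ paths (arms) at the hub, where $\ell_i$ is the number of edges of the $i$-th arm. Given a starting label $c\in[0,n)$, an ordered list of differences $D=(d_0,d_1,\dots,d_{p-1})$ and an initial sign $\varepsilon\in\{+1,-1\}$, define $x_0=c$ and $x_{i+1}=x_i+(-1)^i\varepsilon d_i$ for $i=0,\dots,p-1$; then $\mathrm{arm\_walk}(c,D,\varepsilon,n)=(x_1,\dots,x_p)$. The differences used by an arm are the absolute differences of labels along its edges, including the edge from the hub to the first vertex of the arm. *)

theory Defs
  imports Main
begin

text \<open>The spider \<open>S(l\<^sub>1, \<dots>, l\<^sub>k)\<close>. The vertex \<open>Arm i j\<close> is the one at distance \<open>j\<close> from the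
  hub on arm \<open>i\<close>; arms and positions are counted from 1. Edges are two-element vertex sets.\<close>

datatype vertex = Hub | Arm nat nat

definition arm :: "(nat \<Rightarrow> nat) \<Rightarrow> nat \<Rightarrow> vertex list" where
  "arm l i = map (Arm i) [1..<l i + 1]"

definition arm_edges :: "(nat \<Rightarrow> nat) \<Rightarrow> nat \<Rightarrow> vertex set set" where
  "arm_edges l i = {{(Hub # arm l i) ! j, (Hub # arm l i) ! Suc j} | j. j < l i}"

definition spider_verts :: "nat \<Rightarrow> (nat \<Rightarrow> nat) \<Rightarrow> vertex set" where
  "spider_verts k l = insert Hub (\<Union>i\<in>{1..k}. set (arm l i))"

definition spider_edges :: "nat \<Rightarrow> (nat \<Rightarrow> nat) \<Rightarrow> vertex set set" where
  "spider_edges k l = (\<Union>i\<in>{1..k}. arm_edges l i)"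

lemma card_spider_verts: "card (spider_verts k l) = 1 + (\<Sum>i = 1..k. l i)"
proof -
  have "card (\<Union>i\<in>{1..k}. set (arm l i)) = (\<Sum>i = 1..k. card (set (arm l i)))"
    by (rule card_UN_disjoint) (auto simp: arm_def)
  also have "\<dots> = (\<Sum>i = 1..k. l i)"
    by (intro sum.cong refl, subst distinct_card) (auto simp: arm_def distinct_map inj_on_def)
  finally show ?thesis
    by (auto simp: spider_verts_def arm_def card_insert_if)
qed

definition arm_diffs :: "(vertex \<Rightarrow> int) \<Rightarrow> (nat \<Rightarrow> nat) \<Rightarrow> nat \<Rightarrow> int set" where
  "arm_diffs f l i = {\<bar>f u - f v\<bar> | u v. {u, v} \<in> arm_edges l i}"

primrec walk_label :: "int \<Rightarrow> int list \<Rightarrow> int \<Rightarrow> nat \<Rightarrow> int" where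
  "walk_label c D \<epsilon> 0 = c"
| "walk_label c D \<epsilon> (Suc i) = walk_label c D \<epsilon> i + (- 1) ^ i * \<epsilon> * D ! i"

text \<open>The parameter \<open>n\<close> only records the range \<open>0 \<le> c < n\<close> of admissible starting labels;
  it does not enter the recursion.\<close>

definition arm_walk :: "int \<Rightarrow> int list \<Rightarrow> int \<Rightarrow> nat \<Rightarrow> int list" where
  "arm_walk c D \<epsilon> n = map (walk_label c D \<epsilon>) [1..<length D + 1]"

end

theory Submission imports Defs begin

text \<open>Along an alternating walk whose differences increase in steps of one, the even-indexed and the
  odd-indexed labels each form a run of consecutive integers, moving away from one another. For the
  long arm, started at \<open>H\<close>, one run ends at label 0 and the other at label \<open>n - 1\<close>, so what they leave
  free is the single gap between them, and the hub is at the inner end of its own run.\<close>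

lemma nth_upto_int: "i < length [a..b] \<Longrightarrow> [a..b] ! i = a + int i"
  by (simp add: nth_upto)

text \<open>Two consecutive steps nearly cancel, because their signs alternate and their differences
  are consecutive integers. The net change is \<open>- \<epsilon>\<close> after an even index and
  \<open>+ \<epsilon>\<close> after an odd one, so each parity class drifts by one at a
  time.\<close>

lemma walk_label_upto:
  assumes "i \<le> length [a..b]"
  shows "walk_label c [a..b] \<epsilon> i =
    (if even i then c - \<epsilon> * int (i div 2) else c + \<epsilon> * (a + int (i div 2)))"
  using assms
proof (induction i)
  case 0
  then show ?case by simp
next
  case (Suc i)
  have IH: "walk_label c [a..b] \<epsilon> i =
    (if even i then c - \<epsilon> * int (i div 2) else c + \<epsilon> * (a + int (i div 2)))"
    using Suc by simp
  have nth: "[a..b] ! i = a + int i"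
    using Suc.prems by (intro nth_upto_int) simp
  show ?case
  proof (cases "even i")
    case True
    then obtain j where j: "i = 2 * j" ..
    show ?thesis
      \<comment> \<open>The recursion is unfolded while the index is still \<open>i\<close>, so that
        \<open>IH\<close> and \<open>nth\<close> match; only then is the parity form of
        \<open>i\<close> substituted.\<close>
      by (simp only: walk_label.simps IH nth) (simp add: j algebra_simps)
  next
    case False
    then obtain j where j: "i = 2 * j + 1" by (rule oddE)
    show ?thesis
      by (simp only: walk_label.simps IH nth) (simp add: j algebra_simps)
  qed
qed

text \<open>Indices are split by parity. Index 0 is included, so among \<open>0..p\<close> there are
  \<open>p div 2 + 1\<close> even and \<open>Suc p div 2\<close> odd ones.\<close>

lemma walk_label_upto_image:
  assumes "p \<le> length [a..b]"
  shows "walk_label c [a..b] \<epsilon> ` {..p} =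
    (\<lambda>j. c - \<epsilon> * int j) ` {..<Suc (p div 2)} \<union> (\<lambda>j. c + \<epsilon> * (a + int j)) ` {..<Suc p div 2}"
    (is "?W = ?E \<union> ?O")
proof (intro equalityI subsetI)
  fix x assume "x \<in> ?W"
  then obtain i where i: "i \<le> p" and x: "x = walk_label c [a..b] \<epsilon> i" by auto
  show "x \<in> ?E \<union> ?O"
  proof (cases "even i")
    case True
    then have "x = c - \<epsilon> * int (i div 2)"
      using i x assms by (simp add: walk_label_upto)
    moreover have "i div 2 < Suc (p div 2)" using i by (simp add: div_le_mono less_Suc_eq_le)
    ultimately show ?thesis by blast
  next
    case False
    then have "x = c + \<epsilon> * (a + int (i div 2))"
      using i x assms by (simp add: walk_label_upto)
    moreover have "i div 2 < Suc p div 2" using False i by presburger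
    ultimately show ?thesis by blast
  qed
next
  fix x assume "x \<in> ?E \<union> ?O"
  then consider j where "j < Suc (p div 2)" "x = c - \<epsilon> * int j"
    | j where "j < Suc p div 2" "x = c + \<epsilon> * (a + int j)" by blast
  then show "x \<in> ?W"
  proof cases
    case 1
    then have "2 * j \<le> p" by linarith
    moreover from this have "x = walk_label c [a..b] \<epsilon> (2 * j)"
      using 1 assms by (subst walk_label_upto) auto
    ultimately show ?thesis by blast
  next
    case 2
    then have "2 * j + 1 \<le> p" by linarith
    moreover from this have "x = walk_label c [a..b] \<epsilon> (2 * j + 1)"
      using 2 assms by (subst walk_label_upto) auto
    ultimately show ?thesis by blast
  qed
qed

lemma image_plus_int_lessThan: "(\<lambda>j. u + int j) ` {..<q} = {u..<u + int q}"
proof (intro equalityI subsetI)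
  fix x assume "x \<in> {u..<u + int q}"
  then have "x = u + int (nat (x - u))" "nat (x - u) \<in> {..<q}" by auto
  then show "x \<in> (\<lambda>j. u + int j) ` {..<q}" by blast
qed auto

lemma image_minus_int_lessThan: "(\<lambda>j. u - int j) ` {..<q} = {u - int q<..u}"
proof (intro equalityI subsetI)
  fix x assume "x \<in> {u - int q<..u}"
  then have "x = u - int (nat (u - x))" "nat (u - x) \<in> {..<q}" by auto
  then show "x \<in> (\<lambda>j. u - int j) ` {..<q}" by blast
qed auto

lemma image_walk_label_upto_pos:
  assumes "p \<le> length [a..b]"
  shows "walk_label c [a..b] 1 ` {..p} =
    {c - int (p div 2)..c} \<union> {c + a..<c + a + int (Suc p div 2)}"
proof -
  have "walk_label c [a..b] 1 ` {..p} =
    (\<lambda>j. c - int j) ` {..<Suc (p div 2)} \<union> (\<lambda>j. (c + a) + int j) ` {..<Suc p div 2}"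
    using walk_label_upto_image[OF assms, of c 1] by (simp add: add.assoc)
  then show ?thesis
    unfolding image_plus_int_lessThan image_minus_int_lessThan by auto
qed

lemma image_walk_label_upto_neg:
  assumes "p \<le> length [a..b]"
  shows "walk_label c [a..b] (- 1) ` {..p} =
    {c..c + int (p div 2)} \<union> {c - a - int (Suc p div 2)<..c - a}"
proof -
  have "walk_label c [a..b] (- 1) ` {..p} =
    (\<lambda>j. c + int j) ` {..<Suc (p div 2)} \<union> (\<lambda>j. (c - a) - int j) ` {..<Suc p div 2}"
    using walk_label_upto_image[OF assms, of c "- 1"] by (simp add: algebra_simps)
  then show ?thesis
    unfolding image_plus_int_lessThan image_minus_int_lessThan by auto
qed

lemma length_arm: "length (arm l i) = l i"
  by (simp add: arm_def)

text \<open>\<open>arm_walk\<close> omits the starting label; prepending the hub to the arm restores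
  it, so hub and arm vertices share one indexing.\<close>

lemma label_along_arm:
  assumes "f Hub = c" and "map f (arm l i) = arm_walk c D \<epsilon> n" and "j \<le> l i"
  shows "f ((Hub # arm l i) ! j) = walk_label c D \<epsilon> j"
proof (cases j)
  case 0
  then show ?thesis using assms by simp
next
  case (Suc m)
  have len: "length D = l i"
    using arg_cong[OF assms(2), of length] by (simp add: arm_walk_def length_arm del: upt_Suc)
  have "f (arm l i ! m) = arm_walk c D \<epsilon> n ! m"
    using assms Suc by (simp add: length_arm flip: assms(2))
  also have "\<dots> = walk_label c D \<epsilon> j"
    using assms(3) Suc len by (simp add: arm_walk_def del: upt_Suc)
  finally show ?thesis using Suc by simp
qed

lemma labels_hub_arm:
  assumes "f Hub = c" and "map f (arm l i) = arm_walk c D \<epsilon> n"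
  shows "f ` insert Hub (set (arm l i)) = walk_label c D \<epsilon> ` {..l i}"
proof -
  have "insert Hub (set (arm l i)) = (!) (Hub # arm l i) ` {..l i}"
    using nth_image[of "Suc (l i)" "Hub # arm l i"]
    by (simp add: length_arm lessThan_Suc_atMost atLeast0LessThan)
  then show ?thesis
    using label_along_arm[OF assms] by (simp add: image_image)
qed

lemma arm_diffs_walk:
  assumes "f Hub = c" and "map f (arm l i) = arm_walk c D \<epsilon> n" and "\<bar>\<epsilon>\<bar> = 1"
  shows "arm_diffs f l i = abs ` set D"
proof -
  let ?v = "\<lambda>j. (Hub # arm l i) ! j"
  have len: "length D = l i"
    using arg_cong[OF assms(2), of length] by (simp add: arm_walk_def length_arm del: upt_Suc)
  have step: "\<bar>f (?v j) - f (?v (Suc j))\<bar> = \<bar>D ! j\<bar>" if "j < l i" for j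
  proof -
    have "f (?v j) = walk_label c D \<epsilon> j" "f (?v (Suc j)) = walk_label c D \<epsilon> (Suc j)"
      using that by (intro label_along_arm[OF assms(1,2)]; simp)+
    then show ?thesis
      using assms(3) by (simp only: walk_label.simps) (simp add: abs_mult power_abs)
  qed
  \<comment> \<open>An edge is an unordered pair, so its endpoints may be read in either order;
    symmetry of the absolute difference identifies both readings.\<close>
  have "arm_diffs f l i = {\<bar>f (?v j) - f (?v (Suc j))\<bar> | j. j < l i}"
    unfolding arm_diffs_def arm_edges_def
    by (fastforce simp: doubleton_eq_iff abs_minus_commute)
  also have "\<dots> = {\<bar>D ! j\<bar> | j. j < l i}"
    using step by (metis (no_types, lifting))
  also have "\<dots> = abs ` set D"
    by (auto simp: set_conv_nth len)
  finally show ?thesis .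
qed

theorem lemma3p1:
  fixes k n :: nat and l :: "nat \<Rightarrow> nat" and H R \<epsilon> :: int and f :: "vertex \<Rightarrow> int"
  assumes "k \<ge> 3"
    and "\<forall>i\<in>{1..k}. 1 \<le> l i"
    and "\<forall>i\<in>{1..<k}. l i \<le> l (i + 1)"
    and "n = 1 + (\<Sum>i = 1..k. l i)"
    and "R = int n - 1 - int (l k)"
    and "H = (if even (l k) then int (l k) div 2 else int n - (int (l k) + 1) div 2)"
    and "\<epsilon> = (if even (l k) then 1 else - 1)"
    and "f Hub = H"
    and "map f (arm l k) = arm_walk H [int n - int (l k)..int n - 1] \<epsilon> n"
  shows "arm_diffs f l k = {int n - int (l k)..int n - 1} \<and>
    (\<exists>A B. {0..int n - 1} - f ` insert Hub (set (arm l k)) = {A..B} \<and>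
           int (card {A..B}) = R \<and>
           (even (l k) \<longrightarrow> H = A - 1) \<and>
           (odd (l k) \<longrightarrow> H = B + 1)) \<and>
    {1..int n - 1} - arm_diffs f l k = {1..R}"
proof -
  \<comment> \<open>Counting the hub as well makes the bound strict: the smallest difference
    \<open>n - l k\<close> is then at least 1, and \<open>abs\<close> fixes every
    difference.\<close>
  have "l k \<le> (\<Sum>i = 1..k. l i)"
    by (rule member_le_sum) (use assms(1) in auto)
  then have ln: "l k < n" using assms(4) by simp
  \<comment> \<open>The cardinality of an integer interval is truncated at 0, so equating it with
    \<open>R\<close> below requires \<open>R\<close> to be nonnegative.\<close>
  then have R: "0 \<le> R" using assms(5) by simp
  have lk: "l k \<le> length [int n - int (l k)..int n - 1]" by simp
  have "arm_diffs f l k = abs ` {int n - int (l k)..int n - 1}"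
    using arm_diffs_walk[of f, OF assms(8,9)] assms(7) by simp
  also have "\<dots> = {int n - int (l k)..int n - 1}"
    using ln by (intro image_cong[where g = id, simplified]) auto
  finally have diffs: "arm_diffs f l k = {int n - int (l k)..int n - 1}" .
  have used: "f ` insert Hub (set (arm l k)) =
      walk_label H [int n - int (l k)..int n - 1] \<epsilon> ` {..l k}"
    by (rule labels_hub_arm[OF assms(8,9)])
  have gap: "\<exists>A B. {0..int n - 1} - f ` insert Hub (set (arm l k)) = {A..B} \<and>
           int (card {A..B}) = R \<and>
           (even (l k) \<longrightarrow> H = A - 1) \<and>
           (odd (l k) \<longrightarrow> H = B + 1)"
  proof (cases "even (l k)")
    case True
    then obtain m where m: "l k = 2 * m" ..
    \<comment> \<open>Here \<open>H = m\<close>. The even-indexed labels descend from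
      \<open>m\<close> to 0; the odd-indexed ones start at \<open>m + (n - 2 * m) = n - m\<close>
      and climb for \<open>m\<close> terms to \<open>n - 1\<close>.\<close>
    have "f ` insert Hub (set (arm l k)) = {0..int m} \<union> {int n - int m..<int n}"
      unfolding used using assms(6,7) m image_walk_label_upto_pos[OF lk, of H] by auto
    then have "{0..int n - 1} - f ` insert Hub (set (arm l k)) = {int m + 1..int n - int m - 1}"
      using m ln by auto
    moreover have "int (card {int m + 1..int n - int m - 1}) = R"
      using R assms(5) m by simp
    ultimately show ?thesis using True assms(6) m
      by (intro exI[of _ "int m + 1"] exI[of _ "int n - int m - 1"]) simp
  next
    case False
    then obtain m where m: "l k = 2 * m + 1" by (rule oddE)
    \<comment> \<open>Mirror image with \<open>H = n - m - 1\<close>: the even-indexed labels climb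
      to \<open>n - 1\<close>, and the \<open>m + 1\<close> odd-indexed ones descend from
      \<open>H - (n - 2 * m - 1) = m\<close> to 0.\<close>
    have "f ` insert Hub (set (arm l k)) = {int n - int m - 1..int n - 1} \<union> {- 1<..int m}"
      unfolding used using assms(6,7) m image_walk_label_upto_neg[OF lk, of H] by auto
    then have "{0..int n - 1} - f ` insert Hub (set (arm l k)) = {int m + 1..int n - int m - 2}"
      using m ln by auto
    moreover have "int (card {int m + 1..int n - int m - 2}) = R"
      using R assms(5) m by simp
    ultimately show ?thesis using False assms(6) m
      by (intro exI[of _ "int m + 1"] exI[of _ "int n - int m - 2"]) simp
  qed
  \<comment> \<open>The arm takes the top differences, starting at
    \<open>n - l k = R + 1\<close>.\<close>
  have "{1..int n - 1} - arm_diffs f l k = {1..R}"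
    unfolding diffs using assms(5) by auto
  with diffs gap show ?thesis by blast
qed

end
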